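(* Let $\mathcal{H}$ be a real separable Hilbert space, let $A,B$ be positive invertible operators on $\mathcal{H}$ with $AB=BA$, and let $S=\begin{bmatrix}A&0\\0&B\end{bmatrix}$ on $\mathcal{H}\oplus\mathcal{H}$. Then $S$ is a Gaussian Covariance Operator if and only if all of the following hold: 1. $\hat{A}\ge\hat{B}^{-1}$ on $\hat{\mathcal{H}}$; 2. $A-I$ and $B-I$ are Hilbert-Schmidt operators on $\mathcal{H}$; 3. $AB-I$ is a trace class operator on $\mathcal{H}$.
   Context: Operators are bounded and linear. For a real Hilbert space $\mathcal{K}$, $\hat{\mathcal{K}}=\mathcal{K}+i\mathcal{K}$ is its complexification, and for an operator $T$ on $\mathcal{K}$, $\hat T(x+iy)=Tx+iTy$ is the complexification of $T$ on $\hat{\mathcal{K}}$. The spectrum of $T$ is the spectrum of $\hat T$. An operator on a real Hilbert space is positive invertible if it is self-adjoint and its spectrum is contained in $(0,\infty)$. On $\mathcal{H}\oplus\mathcal{H}$ let $J=\begin{bmatrix}0&I\\-I&0\end{bmatrix}$. A real linear, bounded, symmetric and invertible operator $S$ on $\mathcal{H}\oplus\mathcal{H}$ is a Gaussian Covariance Operator (GCO) if: (i) $\hat S-i\hat J\ge 0$; (ii) $S-I$ is Hilbert-Schmidt; (iii) $(\sqrt S J\sqrt S)^T(\sqrt SJ\sqrt S)-I$ is of trace class. (Condition (i) forces $S\geq 0$, so $\sqrt S$ makes sense.) *)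

theory Defs
  imports "HOL-Analysis.Analysis"
begin

text \<open>
  A real Hilbert space is a type of classes \<^class>\<open>real_inner\<close> and \<^class>\<open>complete_space\<close>.
  Operators are functions; boundedness and linearity are part of each predicate below.
\<close>

section \<open>Operators on a real inner product space\<close>

definition selfadjoint_op :: "('a::real_inner \<Rightarrow> 'a) \<Rightarrow> bool" where
  "selfadjoint_op T \<longleftrightarrow> bounded_linear T \<and> (\<forall>x y. T x \<bullet> y = x \<bullet> T y)"

definition positive_op :: "('a::real_inner \<Rightarrow> 'a) \<Rightarrow> bool" where
  "positive_op T \<longleftrightarrow> selfadjoint_op T \<and> (\<forall>x. 0 \<le> x \<bullet> T x)"

definition invertible_op :: "('a::real_normed_vector \<Rightarrow> 'a) \<Rightarrow> bool" where
  "invertible_op T \<longleftrightarrow>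
     bounded_linear T \<and> (\<exists>R. bounded_linear R \<and> R \<circ> T = id \<and> T \<circ> R = id)"

text \<open>Meaningful for positive \<open>T\<close> on a Hilbert space, where the positive square root is unique.\<close>

definition sqrt_op :: "('a::real_inner \<Rightarrow> 'a) \<Rightarrow> 'a \<Rightarrow> 'a" where
  "sqrt_op T = (THE R. positive_op R \<and> R \<circ> R = T)"

definition abs_op :: "('a::real_inner \<Rightarrow> 'a) \<Rightarrow> 'a \<Rightarrow> 'a" where
  "abs_op T = sqrt_op (adjoint T \<circ> T)"

definition orthonormal_basis :: "'a::real_inner set \<Rightarrow> bool" where
  "orthonormal_basis E \<longleftrightarrow>
     pairwise orthogonal E \<and> (\<forall>e\<in>E. norm e = 1) \<and> closure (span E) = UNIV"

text \<open>
  For a bounded operator on a Hilbert space the two sums below do not depend on the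
  orthonormal basis, so they are required to converge for some basis.
\<close>

definition hilbert_schmidt :: "('a::real_inner \<Rightarrow> 'a) \<Rightarrow> bool" where
  "hilbert_schmidt T \<longleftrightarrow>
     bounded_linear T \<and> (\<exists>E. orthonormal_basis E \<and> (\<lambda>e. (norm (T e))\<^sup>2) summable_on E)"

definition trace_class :: "('a::real_inner \<Rightarrow> 'a) \<Rightarrow> bool" where
  "trace_class T \<longleftrightarrow>
     bounded_linear T \<and> (\<exists>E. orthonormal_basis E \<and> (\<lambda>e. e \<bullet> abs_op T e) summable_on E)"

section \<open>Complexification\<close>

text \<open>
  The pair \<open>(x, y)\<close> stands for \<open>x + \<i>y\<close>. The norm of the product type is the Hilbert space norm
  of the complexification. The inner product is conjugate-linear in its first argument.
\<close>

type_synonym 'a complexification = "'a \<times> 'a"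

definition cscale :: "complex \<Rightarrow> 'a::real_vector complexification \<Rightarrow> 'a complexification" where
  "cscale c = (\<lambda>(x, y). (Re c *\<^sub>R x - Im c *\<^sub>R y, Re c *\<^sub>R y + Im c *\<^sub>R x))"

definition cinner :: "'a::real_inner complexification \<Rightarrow> 'a complexification \<Rightarrow> complex" where
  "cinner = (\<lambda>(x, y) (u, v). Complex (x \<bullet> u + y \<bullet> v) (x \<bullet> v - y \<bullet> u))"

definition complexify :: "('a \<Rightarrow> 'a) \<Rightarrow> 'a complexification \<Rightarrow> 'a complexification" where
  "complexify T = (\<lambda>(x, y). (T x, T y))"

definition cbounded_linear ::
    "('a::real_normed_vector complexification \<Rightarrow> 'a complexification) \<Rightarrow> bool" where
  "cbounded_linear T \<longleftrightarrow> bounded_linear T \<and> (\<forall>c z. T (cscale c z) = cscale c (T z))"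

definition cinvertible_op ::
    "('a::real_normed_vector complexification \<Rightarrow> 'a complexification) \<Rightarrow> bool" where
  "cinvertible_op T \<longleftrightarrow>
     cbounded_linear T \<and> (\<exists>R. cbounded_linear R \<and> R \<circ> T = id \<and> T \<circ> R = id)"

definition cpositive_op ::
    "('a::real_inner complexification \<Rightarrow> 'a complexification) \<Rightarrow> bool" where
  "cpositive_op T \<longleftrightarrow> cbounded_linear T \<and> (\<forall>z. cinner z (T z) \<in> \<real>\<^sub>\<ge>\<^sub>0)"

definition cspectrum ::
    "('a::real_normed_vector complexification \<Rightarrow> 'a complexification) \<Rightarrow> complex set" where
  "cspectrum T = {c. \<not> cinvertible_op (\<lambda>z. T z - cscale c z)}"

definition spectrum :: "('a::real_normed_vector \<Rightarrow> 'a) \<Rightarrow> complex set" where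
  "spectrum T = cspectrum (complexify T)"

definition positive_invertible :: "('a::real_inner \<Rightarrow> 'a) \<Rightarrow> bool" where
  "positive_invertible T \<longleftrightarrow> selfadjoint_op T \<and> spectrum T \<subseteq> complex_of_real ` {0<..}"

section \<open>Gaussian covariance operators\<close>

text \<open>The real Hilbert space \<open>H \<oplus> H\<close> is the product type, with \<open>J = [[0, I], [-I, 0]]\<close>.\<close>

definition J_op :: "'a::real_inner \<times> 'a \<Rightarrow> 'a \<times> 'a" where
  "J_op = (\<lambda>(x, y). (y, - x))"

definition gaussian_covariance_op :: "('a::real_inner \<times> 'a \<Rightarrow> 'a \<times> 'a) \<Rightarrow> bool" where
  "gaussian_covariance_op S \<longleftrightarrow>
     selfadjoint_op S \<and> invertible_op S \<and>
     cpositive_op (\<lambda>z. complexify S z - cscale \<i> (complexify J_op z)) \<and>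
     hilbert_schmidt (\<lambda>x. S x - x) \<and>
     (let K = sqrt_op S \<circ> J_op \<circ> sqrt_op S
      in trace_class (\<lambda>x. (adjoint K \<circ> K) x - x))"

end

theory Submission
  imports Defs
begin

text \<open>
  With \<open>P = \<surd>A\<close> and \<open>Q = \<surd>B\<close>, which commute with \<open>A\<close> and \<open>B\<close>, the operator \<open>K = \<surd>S J \<surd>S\<close> is
  \<open>(x, y) \<mapsto> (P Q y, - Q P x)\<close>, whence \<open>K\<^sup>T K = AB \<oplus> AB\<close>. The form of \<open>S - \<i>J\<close> is a sum of forms
  \<open>\<langle>a, A a\<rangle> + \<langle>b, B b\<rangle> + 2 \<langle>a, b\<rangle>\<close>, and completing the square in \<open>b\<close> shows that these are
  nonnegative iff \<open>A \<ge> B\<^sup>-\<^sup>1\<close>. Since \<open>\<surd>(T \<oplus> U) = \<surd>T \<oplus> \<surd>U\<close> and Hilbert-Schmidt sums do not depend on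
  the basis, direct sums are Hilbert-Schmidt or trace class iff both summands are; for the trace
  class, \<open>T\<close> is trace class iff \<open>\<surd>\<bar>T\<bar>\<close> is Hilbert-Schmidt.
\<close>

section \<open>Positive operators and their square roots\<close>

lemma selfadjoint_opD:
  assumes "selfadjoint_op T"
  shows "bounded_linear T" "linear T" "T x \<bullet> y = x \<bullet> T y"
  using assms by (auto simp: selfadjoint_op_def bounded_linear.linear)

lemma positive_opD:
  assumes "positive_op T"
  shows "selfadjoint_op T" "bounded_linear T" "linear T" "T x \<bullet> y = x \<bullet> T y" "0 \<le> x \<bullet> T x"
  using assms by (auto simp: positive_op_def dest: selfadjoint_opD)

lemma selfadjoint_op_minus:
  assumes "selfadjoint_op S" "selfadjoint_op T"
  shows "selfadjoint_op (\<lambda>x. S x - T x)"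
  using assms by (simp add: selfadjoint_op_def bounded_linear_sub inner_diff_left inner_diff_right)

lemma selfadjoint_op_scaleR: "selfadjoint_op (\<lambda>x. c *\<^sub>R x)"
  by (simp add: selfadjoint_op_def bounded_linear_scaleR_right)

lemma selfadjoint_op_ident: "selfadjoint_op (\<lambda>x. x)"
  by (simp add: selfadjoint_op_def bounded_linear_ident)

section \<open>Cauchy-Schwarz inequality for positive operators\<close>

lemma nonneg_quadratic_discriminant:
  fixes a b c :: real
  assumes "\<And>t. 0 \<le> a + 2 * b * t + c * t\<^sup>2" and "0 \<le> c"
  shows "b\<^sup>2 \<le> a * c"
proof (cases "c = 0")
  case True
  have "b = 0"
  proof (rule ccontr)
    assume "b \<noteq> 0"
    \<comment> \<open>At this \<open>t\<close> the remaining linear polynomial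
      \<open>a + 2 * b * t\<close> equals \<open>- 1\<close>.\<close>
    then show False using assms(1)[of "- (a + 1) / (2 * b)"] True by (simp add: field_simps)
  qed
  then show ?thesis using True by simp
next
  case False
  \<comment> \<open>The polynomial is evaluated at its minimiser \<open>- b / c\<close>.\<close>
  have "0 \<le> a - b\<^sup>2 / c"
    using assms(1)[of "- b / c"] False by (simp add: field_simps power2_eq_square)
  then show ?thesis using assms(2) False by (simp add: field_simps)
qed

text \<open>The form at \<open>x + t *\<^sub>R y\<close> is a nonnegative quadratic polynomial in
  \<open>t\<close>, so its discriminant bounds the mixed term.\<close>

lemma positive_op_Cauchy_Schwarz:
  assumes "positive_op T"
  shows "(x \<bullet> T y)\<^sup>2 \<le> (x \<bullet> T x) * (y \<bullet> T y)"
proof (rule nonneg_quadratic_discriminant)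
  fix t :: real
  have s: "y \<bullet> T x = x \<bullet> T y" using positive_opD(4)[OF assms, of y x] by (simp add: inner_commute)
  have "0 \<le> (x + t *\<^sub>R y) \<bullet> T (x + t *\<^sub>R y)" by (rule positive_opD(5)[OF assms])
  also have "\<dots> = x \<bullet> T x + 2 * (x \<bullet> T y) * t + (y \<bullet> T y) * t\<^sup>2"
    using s by (simp add: linear_add[OF positive_opD(3)[OF assms]] linear_scale[OF positive_opD(3)[OF assms]]
        inner_simps power2_eq_square algebra_simps)
  finally show "0 \<le> x \<bullet> T x + 2 * (x \<bullet> T y) * t + (y \<bullet> T y) * t\<^sup>2" .
qed (rule positive_opD(5)[OF assms])

text \<open>Cauchy-Schwarz with \<open>y = T x\<close>, divided by \<open>T x \<bullet> T x\<close>.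
  It turns bounds on the form into bounds on the norm: for contractivity, for the kernel of the form
  and for the lower bound on the spectrum.\<close>

lemma positive_op_norm_bound:
  assumes T: "positive_op T" and K: "\<And>x. x \<bullet> T x \<le> K * (x \<bullet> x)"
  shows "(norm (T x))\<^sup>2 \<le> K * (x \<bullet> T x)"
proof (cases "T x = 0")
  case False
  let ?n = "T x \<bullet> T x"
  have n: "?n > 0" using False by simp
  have "?n\<^sup>2 \<le> (T x \<bullet> T (T x)) * (x \<bullet> T x)"
    by (rule positive_op_Cauchy_Schwarz[OF T])
  also have "\<dots> \<le> (K * ?n) * (x \<bullet> T x)"
    using K positive_opD(5)[OF T] by (intro mult_right_mono) auto
  finally have "?n * ?n \<le> ?n * (K * (x \<bullet> T x))" by (simp add: power2_eq_square algebra_simps)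
  then have "?n \<le> K * (x \<bullet> T x)" using n by simp
  then show ?thesis by (simp add: power2_norm_eq_inner)
qed simp

lemma bounded_linear_form_bound:
  fixes T :: "'a::real_inner \<Rightarrow> 'a"
  assumes "bounded_linear T"
  obtains K where "K > 0" "\<And>x. x \<bullet> T x \<le> K * (x \<bullet> x)"
proof -
  obtain K where K: "K > 0" "\<And>x. norm (T x) \<le> norm x * K"
    using bounded_linear.pos_bounded[OF assms] by blast
  have "x \<bullet> T x \<le> K * (x \<bullet> x)" for x
  proof -
    have "x \<bullet> T x \<le> norm x * norm (T x)" by (rule norm_cauchy_schwarz)
    also have "\<dots> \<le> norm x * (norm x * K)" using K by (intro mult_left_mono) auto
    finally show ?thesis by (simp add: power2_norm_eq_inner[symmetric] power2_eq_square algebra_simps)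
  qed
  with K(1) that show thesis by blast
qed

lemma positive_op_form_zero:
  assumes "positive_op T" "x \<bullet> T x = 0"
  shows "T x = 0"
proof -
  obtain K where "K > 0" "\<And>x. x \<bullet> T x \<le> K * (x \<bullet> x)"
    using bounded_linear_form_bound[OF positive_opD(2)[OF assms(1)]] by blast
  with positive_op_norm_bound[OF assms(1), of K x] assms(2) show ?thesis by simp
qed

section \<open>Existence of square roots by iteration\<close>

text \<open>The iterates converge to a solution of \<open>2 Y = C + Y\<^sup>2\<close>, so that \<open>(I - Y)\<^sup>2 = I - C\<close>.\<close>

primrec sqrt_iter :: "('a::real_vector \<Rightarrow> 'a) \<Rightarrow> nat \<Rightarrow> 'a \<Rightarrow> 'a" where
  "sqrt_iter C 0 = (\<lambda>x. 0)"
| "sqrt_iter C (Suc n) = (\<lambda>x. (1/2) *\<^sub>R (C x + sqrt_iter C n (sqrt_iter C n x)))"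

text \<open>The scalar recursion with \<open>C = 1\<close>. It majorises the norms of the iterates
  and of their increments, so its convergence carries over to them.\<close>

primrec sqrt_iter_bound :: "nat \<Rightarrow> real" where
  "sqrt_iter_bound 0 = 0"
| "sqrt_iter_bound (Suc n) = (1 + (sqrt_iter_bound n)\<^sup>2) / 2"

lemma sqrt_iter_bound_range: "0 \<le> sqrt_iter_bound n \<and> sqrt_iter_bound n \<le> 1"
proof (induction n)
  case (Suc n)
  then have "(sqrt_iter_bound n)\<^sup>2 \<le> 1" by (simp add: power_le_one)
  then show ?case by simp
qed simp

lemma sqrt_iter_bound_mono: "m \<le> n \<Longrightarrow> sqrt_iter_bound m \<le> sqrt_iter_bound n"
proof (rule lift_Suc_mono_le)
  show "sqrt_iter_bound n \<le> sqrt_iter_bound (Suc n)" for n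
    using sum_squares_bound[of 1 "sqrt_iter_bound n"] by simp
qed

lemma sqrt_iter_bound_Cauchy: "Cauchy sqrt_iter_bound"
proof (rule convergent_Cauchy)
  have "monoseq sqrt_iter_bound" using sqrt_iter_bound_mono unfolding monoseq_def by blast
  moreover have "Bseq sqrt_iter_bound"
    using sqrt_iter_bound_range by (intro BseqI'[where K=1]) auto
  ultimately show "convergent sqrt_iter_bound" by (rule Bseq_monoseq_convergent[rotated])
qed

context
  fixes C :: "'a::real_inner \<Rightarrow> 'a"
  assumes C: "selfadjoint_op C" and C1: "\<And>x. norm (C x) \<le> norm x"
begin

text \<open>Each iterate is a polynomial in \<open>C\<close>. Used for the commutation of iterates
  with each other and for that of the limit with operators commuting with \<open>C\<close>.\<close>

lemma sqrt_iter_commute: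
  assumes "linear G" "\<And>x. G (C x) = C (G x)"
  shows "G (sqrt_iter C n x) = sqrt_iter C n (G x)"
  by (induction n arbitrary: x)
     (simp_all add: linear_0[OF assms(1)] linear_add[OF assms(1)] linear_scale[OF assms(1)] assms(2))

lemma sqrt_iter_linear: "linear (sqrt_iter C n)"
proof (induction n)
  case (Suc n)
  then show ?case using selfadjoint_opD(2)[OF C]
    by (auto intro!: linearI simp: linear_add linear_scale algebra_simps)
qed (simp add: module_hom_zero)

lemma sqrt_iter_selfadjoint: "sqrt_iter C n x \<bullet> y = x \<bullet> sqrt_iter C n y"
  by (induction n arbitrary: x y) (simp_all add: inner_simps selfadjoint_opD(3)[OF C])

lemma sqrt_iter_norm: "norm (sqrt_iter C n x) \<le> sqrt_iter_bound n * norm x"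
proof (induction n arbitrary: x)
  case (Suc n)
  have "norm (sqrt_iter C n (sqrt_iter C n x)) \<le> sqrt_iter_bound n * norm (sqrt_iter C n x)"
    by (rule Suc)
  also have "\<dots> \<le> sqrt_iter_bound n * (sqrt_iter_bound n * norm x)"
    using sqrt_iter_bound_range by (intro mult_left_mono Suc) auto
  finally have "norm (C x + sqrt_iter C n (sqrt_iter C n x)) \<le> norm x + (sqrt_iter_bound n)\<^sup>2 * norm x"
    using C1[of x] by (intro norm_triangle_le) (simp add: power2_eq_square algebra_simps)
  then have "norm ((1/2) *\<^sub>R (C x + sqrt_iter C n (sqrt_iter C n x))) \<le> (norm x + (sqrt_iter_bound n)\<^sup>2 * norm x) / 2"
    unfolding norm_scaleR by simp
  then show ?case by (simp add: algebra_simps add_divide_distrib del: scaleR_add_right)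
qed simp

text \<open>For commuting iterates \<open>Z\<^sup>2 - Y\<^sup>2 = (Z - Y) (Z + Y)\<close>, and the
  two factors are bounded by \<open>c - b\<close> and \<open>c + b\<close>; the majorant satisfies
  the same identity with equality.\<close>

lemma sqrt_iter_Suc_diff:
  "norm (sqrt_iter C (Suc n) x - sqrt_iter C n x)
     \<le> (sqrt_iter_bound (Suc n) - sqrt_iter_bound n) * norm x"
proof (induction n arbitrary: x)
  case 0
  then show ?case using C1 by simp
next
  case (Suc n)
  let ?Y = "sqrt_iter C n" and ?Z = "sqrt_iter C (Suc n)"
  let ?b = "sqrt_iter_bound n" and ?c = "sqrt_iter_bound (Suc n)"
  note lin = sqrt_iter_linear
  \<comment> \<open>\<open>C\<close> commutes with the iterate \<open>Z\<close>, being linear and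
    commuting with itself; hence so does the iterate \<open>Y\<close>.\<close>
  have comm: "?Y (?Z x) = ?Z (?Y x)"
    by (rule sqrt_iter_commute[OF lin]) (rule sqrt_iter_commute[symmetric, OF selfadjoint_opD(2)[OF C] refl])
  have eq: "?Z (?Z x + ?Y x) - ?Y (?Z x + ?Y x) = ?Z (?Z x) - ?Y (?Y x)"
    by (simp only: linear_add[OF lin] comm) simp
  have "norm (?Z (?Z x + ?Y x) - ?Y (?Z x + ?Y x)) \<le> (?c - ?b) * norm (?Z x + ?Y x)"
    by (rule Suc)
  also have "\<dots> \<le> (?c - ?b) * ((?c + ?b) * norm x)"
    using sqrt_iter_norm[of n x] sqrt_iter_norm[of "Suc n" x] sqrt_iter_bound_mono[of n "Suc n"]
    by (intro mult_left_mono norm_triangle_le) (simp_all add: algebra_simps del: sqrt_iter.simps sqrt_iter_bound.simps)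
  finally have main: "norm (?Z (?Z x) - ?Y (?Y x)) \<le> (?c\<^sup>2 - ?b\<^sup>2) * norm x"
    unfolding eq by (simp only: power2_eq_square algebra_simps)
  have "sqrt_iter C (Suc (Suc n)) x - ?Z x = (1/2) *\<^sub>R (?Z (?Z x) - ?Y (?Y x))"
    unfolding sqrt_iter.simps(2)[of C "Suc n"] by (subst (3) sqrt_iter.simps(2)) (simp only: algebra_simps)
  then have "norm (sqrt_iter C (Suc (Suc n)) x - ?Z x) = norm (?Z (?Z x) - ?Y (?Y x)) / 2"
    by (simp only: norm_scaleR)
  also have "\<dots> \<le> (?c\<^sup>2 - ?b\<^sup>2) * norm x / 2" using main by simp
  also have "\<dots> = (sqrt_iter_bound (Suc (Suc n)) - ?c) * norm x"
    unfolding sqrt_iter_bound.simps(2)[of "Suc n"] by (subst (3) sqrt_iter_bound.simps(2)) (simp add: field_simps)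
  finally show ?case .
qed

lemma sqrt_iter_diff:
  assumes "m \<le> n"
  shows "norm (sqrt_iter C n x - sqrt_iter C m x) \<le> (sqrt_iter_bound n - sqrt_iter_bound m) * norm x"
  using assms
proof (induction n rule: dec_induct)
  case (step n)
  have "norm (sqrt_iter C (Suc n) x - sqrt_iter C m x)
      \<le> norm (sqrt_iter C (Suc n) x - sqrt_iter C n x) + norm (sqrt_iter C n x - sqrt_iter C m x)"
    by (rule order_trans[OF _ norm_triangle_ineq]) (simp del: sqrt_iter.simps)
  also have "\<dots> \<le> (sqrt_iter_bound (Suc n) - sqrt_iter_bound n) * norm x
      + (sqrt_iter_bound n - sqrt_iter_bound m) * norm x"
    by (intro add_mono sqrt_iter_Suc_diff step)
  finally show ?case by (simp only: algebra_simps)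
qed simp

lemma sqrt_iter_Cauchy: "Cauchy (\<lambda>n. sqrt_iter C n x)"
proof (rule CauchyI')
  fix e :: real assume "e > 0"
  \<comment> \<open>Adding 1 to \<open>norm x\<close> keeps the denominator positive when
    \<open>x = 0\<close>.\<close>
  then have e: "e / (norm x + 1) > 0" by (intro divide_pos_pos) (auto intro: add_nonneg_pos)
  obtain M where M: "\<And>m n. m \<ge> M \<Longrightarrow> n \<ge> M \<Longrightarrow> norm (sqrt_iter_bound m - sqrt_iter_bound n) < e / (norm x + 1)"
    using CauchyD[OF sqrt_iter_bound_Cauchy e] by blast
  have "norm (sqrt_iter C m x - sqrt_iter C n x) < e" if "m \<ge> M" "n > m" for m n
  proof -
    have "norm (sqrt_iter C m x - sqrt_iter C n x) \<le> (sqrt_iter_bound n - sqrt_iter_bound m) * norm x"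
      using sqrt_iter_diff[of m n x] that by (simp add: norm_minus_commute)
    also have "\<dots> \<le> (sqrt_iter_bound n - sqrt_iter_bound m) * (norm x + 1)"
      using sqrt_iter_bound_mono[of m n] that by (intro mult_left_mono) auto
    also have "\<dots> < (e / (norm x + 1)) * (norm x + 1)"
      using M[of n m] that norm_ge_zero[of x] by (intro mult_strict_right_mono) (auto simp del: norm_ge_zero)
    also have "\<dots> = e" using norm_ge_zero[of x] by (simp add: add_nonneg_eq_0_iff)
    finally show ?thesis .
  qed
  then show "\<exists>M. \<forall>m\<ge>M. \<forall>n>m. dist (sqrt_iter C m x) (sqrt_iter C n x) < e"
    unfolding dist_norm by blast
qed

end

text \<open>\<open>Y\<close> is the pointwise limit of the iterates; linearity, symmetry,
  contractivity, the recursion and commutation all pass to the limit.\<close>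

lemma sqrt_contraction:
  fixes C :: "'a::{real_inner, complete_space} \<Rightarrow> 'a"
  assumes C: "selfadjoint_op C" and C1: "\<And>x. norm (C x) \<le> norm x"
  obtains Y where "selfadjoint_op Y" "\<And>x. norm (Y x) \<le> norm x" "\<And>x. 2 *\<^sub>R Y x = C x + Y (Y x)"
    "\<And>G x. bounded_linear G \<Longrightarrow> (\<And>x. G (C x) = C (G x)) \<Longrightarrow> G (Y x) = Y (G x)"
proof -
  define Y where "Y x = lim (\<lambda>n. sqrt_iter C n x)" for x
  have lim: "(\<lambda>n. sqrt_iter C n x) \<longlonglongrightarrow> Y x" for x
    unfolding Y_def using sqrt_iter_Cauchy[OF C C1] Cauchy_convergent_iff convergent_LIMSEQ_iff by blast
  have it1: "norm (sqrt_iter C n x) \<le> norm x" for n x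
    using sqrt_iter_norm[OF C C1, of n x] sqrt_iter_bound_range[of n]
      mult_right_mono[of "sqrt_iter_bound n" 1 "norm x"] by simp
  have Y1: "norm (Y x) \<le> norm x" for x
    by (rule tendsto_upperbound[OF tendsto_norm[OF lim]]) (auto simp: it1)
  have add: "Y (x + y) = Y x + Y y" for x y
  proof (rule LIMSEQ_unique[OF lim])
    show "(\<lambda>n. sqrt_iter C n (x + y)) \<longlonglongrightarrow> Y x + Y y"
      unfolding linear_add[OF sqrt_iter_linear[OF C C1]] by (intro tendsto_add lim)
  qed
  have scale: "Y (r *\<^sub>R x) = r *\<^sub>R Y x" for r x
  proof (rule LIMSEQ_unique[OF lim])
    show "(\<lambda>n. sqrt_iter C n (r *\<^sub>R x)) \<longlonglongrightarrow> r *\<^sub>R Y x"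
      unfolding linear_scale[OF sqrt_iter_linear[OF C C1]] by (intro tendsto_intros lim)
  qed
  have bl: "bounded_linear Y" by (rule bounded_linear_intro[where K=1]) (auto simp: add scale Y1)
  have sa: "Y x \<bullet> y = x \<bullet> Y y" for x y
  proof (rule LIMSEQ_unique)
    show "(\<lambda>n. sqrt_iter C n x \<bullet> y) \<longlonglongrightarrow> Y x \<bullet> y" by (intro tendsto_intros lim)
    show "(\<lambda>n. sqrt_iter C n x \<bullet> y) \<longlonglongrightarrow> x \<bullet> Y y"
      unfolding sqrt_iter_selfadjoint[OF C C1] by (intro tendsto_intros lim)
  qed
  \<comment> \<open>Squares converge pointwise because the iterates are uniformly contractive:
    applying the \<open>n\<close>-th one to \<open>sqrt_iter C n x - Y x\<close> still tends to
    0.\<close>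
  have sq: "(\<lambda>n. sqrt_iter C n (sqrt_iter C n x)) \<longlonglongrightarrow> Y (Y x)" for x
  proof (rule Lim_transform)
    show "(\<lambda>n. sqrt_iter C n (Y x)) \<longlonglongrightarrow> Y (Y x)" by (rule lim)
    have "(\<lambda>n. norm (sqrt_iter C n x - Y x)) \<longlonglongrightarrow> 0"
      using lim LIM_zero tendsto_norm_zero by blast
    then have "(\<lambda>n. sqrt_iter C n (sqrt_iter C n x - Y x)) \<longlonglongrightarrow> 0"
      by (rule Lim_null_comparison[rotated]) (simp add: it1)
    then show "(\<lambda>n. sqrt_iter C n (sqrt_iter C n x) - sqrt_iter C n (Y x)) \<longlonglongrightarrow> 0"
      by (simp add: linear_diff[OF sqrt_iter_linear[OF C C1]])
  qed
  have fix_eq: "Y x = (1/2) *\<^sub>R (C x + Y (Y x))" for x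
  proof (rule LIMSEQ_unique)
    show "(\<lambda>n. sqrt_iter C (Suc n) x) \<longlonglongrightarrow> Y x" by (rule LIMSEQ_Suc[OF lim])
    show "(\<lambda>n. sqrt_iter C (Suc n) x) \<longlonglongrightarrow> (1/2) *\<^sub>R (C x + Y (Y x))"
      unfolding sqrt_iter.simps by (intro tendsto_intros sq)
  qed
  have comm: "G (Y x) = Y (G x)" if "bounded_linear G" "\<And>x. G (C x) = C (G x)" for G x
  proof (rule LIMSEQ_unique)
    show "(\<lambda>n. G (sqrt_iter C n x)) \<longlonglongrightarrow> G (Y x)" by (rule bounded_linear.tendsto[OF that(1) lim])
    show "(\<lambda>n. G (sqrt_iter C n x)) \<longlonglongrightarrow> Y (G x)"
      unfolding sqrt_iter_commute[OF C C1 bounded_linear.linear[OF that(1)] that(2)] by (rule lim)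
  qed
  show thesis
  proof (rule that[of Y])
    show "selfadjoint_op Y" using bl sa by (simp add: selfadjoint_op_def)
    show "2 *\<^sub>R Y x = C x + Y (Y x)" for x by (subst fix_eq) simp
  qed (auto simp: Y1 intro: comm)
qed

text \<open>Scaling by a form bound \<open>K\<close> makes \<open>C = I - T / K\<close> satisfy
  \<open>0 \<le> C \<le> I\<close>; the root is then \<open>sqrt K (I - Y)\<close>. The commutation
  clause drives both uniqueness and the later use of \<open>A B = B A\<close>.\<close>

lemma positive_op_sqrt_exists:
  fixes T :: "'a::{real_inner, complete_space} \<Rightarrow> 'a"
  assumes T: "positive_op T"
  obtains R where "positive_op R" "R \<circ> R = T"
    "\<And>G. bounded_linear G \<Longrightarrow> G \<circ> T = T \<circ> G \<Longrightarrow> G \<circ> R = R \<circ> G"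
proof -
  obtain K where K: "K > 0" "\<And>x. x \<bullet> T x \<le> K * (x \<bullet> x)"
    using bounded_linear_form_bound[OF positive_opD(2)[OF T]] by blast
  define C where "C x = x - (1/K) *\<^sub>R T x" for x
  have lin: "linear T" by (rule positive_opD(3)[OF T])
  have blC: "bounded_linear C" unfolding C_def
    by (intro bounded_linear_sub bounded_linear_ident bounded_linear_const_scaleR positive_opD(2)[OF T])
  have C: "positive_op C"
    unfolding positive_op_def selfadjoint_op_def
  proof (intro conjI allI blC)
    show "C x \<bullet> y = x \<bullet> C y" for x y
      by (simp add: C_def inner_diff_left inner_diff_right positive_opD(4)[OF T])
    show "0 \<le> x \<bullet> C x" for x using K(1) K(2)[of x] by (simp add: C_def inner_diff_right field_simps)
  qed
  have "x \<bullet> C x \<le> 1 * (x \<bullet> x)" for x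
    using K(1) positive_opD(5)[OF T, of x] by (simp add: C_def inner_diff_right)
  \<comment> \<open>Chained bounds: \<open>(norm (C x))\<^sup>2 \<le> x \<bullet> C x \<le> x
    \<bullet> x\<close>.\<close>
  then have "(norm (C x))\<^sup>2 \<le> (norm x)\<^sup>2" for x
    using positive_op_norm_bound[OF C, of 1 x] by (simp add: power2_norm_eq_inner) (meson order_trans)
  then have C1: "norm (C x) \<le> norm x" for x by simp
  obtain Y where Y: "selfadjoint_op Y" "\<And>x. norm (Y x) \<le> norm x" "\<And>x. 2 *\<^sub>R Y x = C x + Y (Y x)"
    "\<And>G x. bounded_linear G \<Longrightarrow> (\<And>x. G (C x) = C (G x)) \<Longrightarrow> G (Y x) = Y (G x)"
    using sqrt_contraction[OF positive_opD(1)[OF C] C1] by metis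
  define R where "R x = sqrt K *\<^sub>R (x - Y x)" for x
  note linY = selfadjoint_opD(2)[OF Y(1)]
  have "positive_op R"
    unfolding positive_op_def selfadjoint_op_def
  proof (intro conjI allI)
    show "bounded_linear R" unfolding R_def
      by (intro bounded_linear_sub bounded_linear_ident bounded_linear_const_scaleR selfadjoint_opD(1)[OF Y(1)])
    show "R x \<bullet> y = x \<bullet> R y" for x y
      by (simp add: R_def inner_diff_left inner_diff_right selfadjoint_opD(3)[OF Y(1)])
    fix x
    have "x \<bullet> Y x \<le> norm x * norm (Y x)" by (rule norm_cauchy_schwarz)
    also have "\<dots> \<le> norm x * norm x" by (intro mult_left_mono Y) auto
    finally have "x \<bullet> Y x \<le> x \<bullet> x" by (simp add: power2_norm_eq_inner[symmetric] power2_eq_square)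
    then show "0 \<le> x \<bullet> R x" using K(1) by (simp add: R_def inner_diff_right)
  qed
  moreover have "R \<circ> R = T"
  proof
    fix x
    have "R (R x) = (sqrt K * sqrt K) *\<^sub>R (x - 2 *\<^sub>R Y x + Y (Y x))"
      by (simp add: R_def linear_scale[OF linY] linear_diff[OF linY] scaleR_2 algebra_simps)
    also have "\<dots> = K *\<^sub>R (x - 2 *\<^sub>R Y x + Y (Y x))" using K(1) by simp
    also have "\<dots> = K *\<^sub>R (x - C x)" by (simp add: Y(3))
    also have "\<dots> = T x" using K(1) by (simp add: C_def)
    finally show "(R \<circ> R) x = T x" by simp
  qed
  moreover have "G \<circ> R = R \<circ> G" if G: "bounded_linear G" "G \<circ> T = T \<circ> G" for G
  proof
    fix x
    note linG = bounded_linear.linear[OF G(1)]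
    have "G (C x) = C (G x)" for x
      using fun_cong[OF G(2), of x] by (simp add: C_def linear_diff[OF linG] linear_scale[OF linG])
    then show "(G \<circ> R) x = (R \<circ> G) x"
      by (simp add: R_def linear_diff[OF linG] linear_scale[OF linG] Y(4)[OF G(1)])
  qed
  ultimately show thesis using that by blast
qed

section \<open>Uniqueness of square roots\<close>

text \<open>Commutation gives \<open>(P + R) (P - R) = P\<^sup>2 - R\<^sup>2 = 0\<close>. On the
  range of \<open>P - R\<close> the nonnegative forms of \<open>P\<close> and \<open>R\<close>
  therefore sum to 0, so both operators vanish there.\<close>

lemma positive_op_sqrt_unique:
  fixes T :: "'a::{real_inner, complete_space} \<Rightarrow> 'a"
  assumes P: "positive_op P" "P \<circ> P = T" and R: "positive_op R" "R \<circ> R = T" and PR: "P \<circ> R = R \<circ> P"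
  shows "P = R"
proof
  fix x
  define y where "y = P x - R x"
  note linP = positive_opD(3)[OF P(1)] and linR = positive_opD(3)[OF R(1)]
  have PP: "P (P x) = T x" "R (R x) = T x" "P (R x) = R (P x)"
    using P(2) R(2) PR by (auto simp: fun_eq_iff)
  have "P y + R y = 0" unfolding y_def by (simp add: linear_diff[OF linP] linear_diff[OF linR] PP)
  then have "y \<bullet> P y + y \<bullet> R y = 0" by (metis inner_add_right inner_zero_right)
  then have "y \<bullet> P y = 0" "y \<bullet> R y = 0"
    using positive_opD(5)[OF P(1), of y] positive_opD(5)[OF R(1), of y] by auto
  then have "P y = 0" "R y = 0" using P(1) R(1) positive_op_form_zero by blast+
  moreover have "y \<bullet> y = x \<bullet> (P y - R y)"
    by (subst (1) y_def) (simp add: inner_simps positive_opD(4)[OF P(1)] positive_opD(4)[OF R(1)])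
  ultimately show "P x = R x" by (simp add: y_def)
qed

text \<open>A root of \<open>T\<close> commutes with \<open>T\<close>, hence with the constructed
  root \<open>Q\<close>; so any two positive roots are compared through \<open>Q\<close>.\<close>

lemma sqrt_op_eq:
  fixes R :: "'a::{real_inner, complete_space} \<Rightarrow> 'a"
  assumes R: "positive_op R" "R \<circ> R = T"
  shows "sqrt_op T = R"
  unfolding sqrt_op_def
proof (rule the_equality)
  fix P assume P: "positive_op P \<and> P \<circ> P = T"
  have "positive_op T" unfolding positive_op_def selfadjoint_op_def
  proof (intro conjI allI)
    show "bounded_linear T" unfolding R(2)[symmetric]
      by (simp add: o_def bounded_linear_compose positive_opD(2)[OF R(1)])
    show "T x \<bullet> y = x \<bullet> T y" for x y unfolding R(2)[symmetric] by (simp add: positive_opD(4)[OF R(1)])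
    show "0 \<le> x \<bullet> T x" for x unfolding R(2)[symmetric]
      using positive_opD(4)[OF R(1), of x "R x"] inner_ge_zero[of "R x"] by simp
  qed
  then obtain Q where Q: "positive_op Q" "Q \<circ> Q = T"
    "\<And>G. bounded_linear G \<Longrightarrow> G \<circ> T = T \<circ> G \<Longrightarrow> G \<circ> Q = Q \<circ> G"
    using positive_op_sqrt_exists by blast
  have "P = Q"
    using P by (intro positive_op_sqrt_unique[OF _ _ Q(1,2)] Q(3)) (auto simp: o_assoc dest: positive_opD)
  moreover have "R = Q"
    using R by (intro positive_op_sqrt_unique[OF _ _ Q(1,2)] Q(3)) (auto simp: o_assoc dest: positive_opD)
  ultimately show "P = R" by simp
qed (use assms in simp)

lemma sqrt_op_works:
  fixes T :: "'a::{real_inner, complete_space} \<Rightarrow> 'a"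
  assumes "positive_op T"
  shows "positive_op (sqrt_op T)" "sqrt_op T \<circ> sqrt_op T = T"
    "\<And>G. bounded_linear G \<Longrightarrow> G \<circ> T = T \<circ> G \<Longrightarrow> G \<circ> sqrt_op T = sqrt_op T \<circ> G"
proof -
  obtain R where R: "positive_op R" "R \<circ> R = T"
    "\<And>G. bounded_linear G \<Longrightarrow> G \<circ> T = T \<circ> G \<Longrightarrow> G \<circ> R = R \<circ> G"
    using positive_op_sqrt_exists[OF assms] by blast
  have "sqrt_op T = R" by (rule sqrt_op_eq[OF R(1,2)])
  then show "positive_op (sqrt_op T)" "sqrt_op T \<circ> sqrt_op T = T"
    "\<And>G. bounded_linear G \<Longrightarrow> G \<circ> T = T \<circ> G \<Longrightarrow> G \<circ> sqrt_op T = sqrt_op T \<circ> G" using R by auto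
qed

section \<open>Orthonormal bases\<close>

text \<open>The basis condition without density of the span: the setting of Bessel's inequality and
  the family to which Zorn's lemma is applied.\<close>

definition orthonormal :: "'a::real_inner set \<Rightarrow> bool" where
  "orthonormal E \<longleftrightarrow> pairwise orthogonal E \<and> (\<forall>e\<in>E. norm e = 1)"

lemma orthonormal_basis_imp_orthonormal: "orthonormal_basis E \<Longrightarrow> orthonormal E"
  by (simp add: orthonormal_basis_def orthonormal_def)

text \<open>Pythagoras and completing the square in the coefficients. Fourier coefficients
  \<open>c\<close> give Bessel; arbitrary \<open>c\<close> shows that they approximate best, as
  Parseval requires.\<close>

lemma orthonormal_norm_diff_sum:
  assumes E: "orthonormal E" and F: "finite F" "F \<subseteq> E"
  shows "(norm (x - (\<Sum>e\<in>F. c e *\<^sub>R e)))\<^sup>2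
    = (norm x)\<^sup>2 - (\<Sum>e\<in>F. (x \<bullet> e)\<^sup>2) + (\<Sum>e\<in>F. (c e - x \<bullet> e)\<^sup>2)"
proof -
  have 1: "norm e = 1" if "e \<in> F" for e using E F that by (auto simp: orthonormal_def)
  have "pairwise orthogonal F" using E F(2) unfolding orthonormal_def by (metis pairwise_subset)
  then have "pairwise (\<lambda>i j. orthogonal (c i *\<^sub>R i) (c j *\<^sub>R j)) F"
    by (auto simp: pairwise_def orthogonal_clauses)
  then have "(norm (\<Sum>e\<in>F. c e *\<^sub>R e))\<^sup>2 = (\<Sum>e\<in>F. (norm (c e *\<^sub>R e))\<^sup>2)"
    using F(1) by (simp add: norm_sum_Pythagorean)
  also have "\<dots> = (\<Sum>e\<in>F. (c e)\<^sup>2)" by (rule sum.cong) (auto simp: 1)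
  finally have 2: "(norm (\<Sum>e\<in>F. c e *\<^sub>R e))\<^sup>2 = (\<Sum>e\<in>F. (c e)\<^sup>2)" .
  have "(norm (x - (\<Sum>e\<in>F. c e *\<^sub>R e)))\<^sup>2
     = (norm x)\<^sup>2 - 2 * (x \<bullet> (\<Sum>e\<in>F. c e *\<^sub>R e)) + (norm (\<Sum>e\<in>F. c e *\<^sub>R e))\<^sup>2"
    by (simp only: power2_norm_eq_inner inner_diff_left inner_diff_right) (simp add: inner_commute)
  also have "x \<bullet> (\<Sum>e\<in>F. c e *\<^sub>R e) = (\<Sum>e\<in>F. c e * (x \<bullet> e))" by (simp add: inner_sum_right)
  also have "(norm x)\<^sup>2 - 2 * (\<Sum>e\<in>F. c e * (x \<bullet> e)) + (norm (\<Sum>e\<in>F. c e *\<^sub>R e))\<^sup>2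
     = (norm x)\<^sup>2 - (\<Sum>e\<in>F. (x \<bullet> e)\<^sup>2) + (\<Sum>e\<in>F. (c e - x \<bullet> e)\<^sup>2)"
    unfolding 2 by (simp add: power2_diff sum.distrib sum_subtractf sum_distrib_left algebra_simps)
  finally show ?thesis .
qed

lemma Bessel_inequality:
  assumes "orthonormal E" "finite F" "F \<subseteq> E"
  shows "(\<Sum>e\<in>F. (x \<bullet> e)\<^sup>2) \<le> (norm x)\<^sup>2"
  using orthonormal_norm_diff_sum[OF assms, of x "\<lambda>e. x \<bullet> e"]
    zero_le_power2[of "norm (x - (\<Sum>e\<in>F. (x \<bullet> e) *\<^sub>R e))"]
  by (simp del: zero_le_power2)

text \<open>Bessel gives one inequality. For the other, a finite combination close to
  \<open>x\<close> is at least as far from \<open>x\<close> as the partial Fourier sum over the same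
  vectors.\<close>

lemma Parseval:
  assumes E: "orthonormal_basis E"
  shows "((\<lambda>e. (x \<bullet> e)\<^sup>2) has_sum (norm x)\<^sup>2) E"
proof -
  note on = orthonormal_basis_imp_orthonormal[OF E]
  have sm: "(\<lambda>e. (x \<bullet> e)\<^sup>2) summable_on E"
    using Bessel_inequality[OF on] by (intro nonneg_bdd_above_summable_on) (auto intro!: bdd_aboveI)
  have "infsum (\<lambda>e. (x \<bullet> e)\<^sup>2) E \<le> (norm x)\<^sup>2"
    by (rule infsum_le_finite_sums[OF sm]) (rule Bessel_inequality[OF on])
  moreover have "(norm x)\<^sup>2 \<le> infsum (\<lambda>e. (x \<bullet> e)\<^sup>2) E"
  proof (rule field_le_epsilon)
    fix d :: real assume d: "d > 0"
    have "x \<in> closure (span E)" using E by (simp add: orthonormal_basis_def)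
    \<comment> \<open>Distance \<open>sqrt d\<close> makes the squared error at most
      \<open>d\<close>.\<close>
    then obtain y where y: "y \<in> span E" "dist y x < sqrt d"
      using d unfolding closure_approachable by (metis real_sqrt_gt_zero)
    obtain F c where F: "finite F" "F \<subseteq> E" "y = (\<Sum>e\<in>F. c e *\<^sub>R e)"
      using y(1) unfolding span_explicit by blast
    have "(norm (x - y))\<^sup>2 \<le> d"
      using y(2) d by (metis dist_norm dist_commute less_imp_le norm_ge_zero power_mono real_sqrt_pow2)
    then have "(norm x)\<^sup>2 - (\<Sum>e\<in>F. (x \<bullet> e)\<^sup>2) + (\<Sum>e\<in>F. (c e - x \<bullet> e)\<^sup>2) \<le> d"
      unfolding F(3) orthonormal_norm_diff_sum[OF on F(1,2)] .
    moreover have "0 \<le> (\<Sum>e\<in>F. (c e - x \<bullet> e)\<^sup>2)" by (rule sum_nonneg) simp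
    moreover have "(\<Sum>e\<in>F. (x \<bullet> e)\<^sup>2) \<le> infsum (\<lambda>e. (x \<bullet> e)\<^sup>2) E"
      using F by (intro finite_sum_le_infsum[OF sm]) auto
    ultimately show "(norm x)\<^sup>2 \<le> infsum (\<lambda>e. (x \<bullet> e)\<^sup>2) E + d" by linarith
  qed
  ultimately show ?thesis using has_sum_infsum[OF sm] by simp
qed

section \<open>Orthogonal projection and existence of orthonormal bases\<close>

text \<open>A minimising sequence for the distance to \<open>V\<close> is Cauchy by the
  parallelogram law, and its limit satisfies the first-order condition. Since \<open>V\<close> need
  not be closed, the limit is located in \<open>closure V\<close>.\<close>

lemma orthogonal_residual_exists:
  fixes V :: "'a::{real_inner, complete_space} set"
  assumes V: "subspace V"
  obtains y where "y \<in> closure V" "\<And>z. z \<in> V \<Longrightarrow> (x - y) \<bullet> z = 0"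
proof -
  define D where "D = (INF v\<in>V. (norm (x - v))\<^sup>2)"
  have ne: "V \<noteq> {}" using subspace_0[OF V] by blast
  have bdd: "bdd_below ((\<lambda>v. (norm (x - v))\<^sup>2) ` V)" by (intro bdd_belowI[of _ 0]) auto
  have low: "D \<le> (norm (x - v))\<^sup>2" if "v \<in> V" for v unfolding D_def by (rule cINF_lower[OF bdd that])
  have "\<exists>v\<in>V. (norm (x - v))\<^sup>2 < D + inverse (real (Suc n))" for n
    using cINF_less_iff[OF ne bdd, of "D + inverse (real (Suc n))"] by (simp add: D_def)
  then obtain u where u: "\<And>n. u n \<in> V" "\<And>n. (norm (x - u n))\<^sup>2 < D + inverse (real (Suc n))" by metis
  \<comment> \<open>Parallelogram law for \<open>x - a\<close> and \<open>x - b\<close>.\<close>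
  have par: "(norm (a - b))\<^sup>2 = 2 * (norm (x - a))\<^sup>2 + 2 * (norm (x - b))\<^sup>2
      - 4 * (norm (x - (1/2) *\<^sub>R (a + b)))\<^sup>2" for a b
    by (simp add: power2_norm_eq_inner inner_simps inner_commute algebra_simps)
  have "Cauchy u"
  proof (rule CauchyI)
    fix e :: real assume e: "e > 0"
    \<comment> \<open>The two excesses over \<open>D\<close> enter with factor 2 each, hence the
      quarter.\<close>
    then obtain M where M: "inverse (real (Suc M)) < e\<^sup>2 / 4" using reals_Archimedean[of "e\<^sup>2 / 4"] by auto
    have "norm (u m - u n) < e" if "m \<ge> M" "n \<ge> M" for m n
    proof -
      have "(1/2) *\<^sub>R (u m + u n) \<in> V" using V u(1) by (intro subspace_scale subspace_add)
      then have "D \<le> (norm (x - (1/2) *\<^sub>R (u m + u n)))\<^sup>2" by (rule low)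
      moreover have "inverse (real (Suc m)) \<le> inverse (real (Suc M))" "inverse (real (Suc n)) \<le> inverse (real (Suc M))"
        using that by (auto intro!: le_imp_inverse_le)
      ultimately have "(norm (u m - u n))\<^sup>2 < e\<^sup>2" using par[of "u m" "u n"] u(2)[of m] u(2)[of n] M by linarith
      then show ?thesis using e by (simp add: power_less_imp_less_base)
    qed
    then show "\<exists>M. \<forall>m\<ge>M. \<forall>n\<ge>M. norm (u m - u n) < e" by blast
  qed
  then obtain y where y: "u \<longlonglongrightarrow> y" using Cauchy_convergent_iff convergent_def by blast
  have yD: "(norm (x - y))\<^sup>2 \<le> D"
  proof (rule tendsto_le)
    show "(\<lambda>n. (norm (x - u n))\<^sup>2) \<longlonglongrightarrow> (norm (x - y))\<^sup>2" by (intro tendsto_intros y)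
    show "(\<lambda>n. D + inverse (real (Suc n))) \<longlonglongrightarrow> D"
      using tendsto_add[OF tendsto_const LIMSEQ_inverse_real_of_nat, of D] by simp
  qed (simp, intro always_eventually allI less_imp_le u(2))
  have min: "D \<le> (norm (x - (y + z)))\<^sup>2" if "z \<in> V" for z
  proof (rule tendsto_lowerbound)
    show "(\<lambda>n. (norm (x - (u n + z)))\<^sup>2) \<longlonglongrightarrow> (norm (x - (y + z)))\<^sup>2" by (intro tendsto_intros y)
    show "\<forall>\<^sub>F n in sequentially. D \<le> (norm (x - (u n + z)))\<^sup>2"
      using that u(1) by (intro always_eventually allI low subspace_add[OF V])
  qed simp
  have "(x - y) \<bullet> z = 0" if "z \<in> V" for z
  proof -
    \<comment> \<open>The squared distance along \<open>y + t *\<^sub>R z\<close> is minimal at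
      \<open>t = 0\<close>; with constant term 0 the discriminant bound forces the linear
      coefficient to vanish.\<close>
    have "0 \<le> 0 + 2 * (- ((x - y) \<bullet> z)) * t + (z \<bullet> z) * t\<^sup>2" for t
    proof -
      have "(norm (x - (y + t *\<^sub>R z)))\<^sup>2 = (norm (x - y))\<^sup>2 + 2 * (- ((x - y) \<bullet> z)) * t + (z \<bullet> z) * t\<^sup>2"
        unfolding power2_norm_eq_inner by (simp add: inner_simps inner_commute power2_eq_square algebra_simps)
      with min[of "t *\<^sub>R z"] yD subspace_scale[OF V that] show ?thesis by fastforce
    qed
    then have "(- ((x - y) \<bullet> z))\<^sup>2 \<le> 0 * (z \<bullet> z)" by (rule nonneg_quadratic_discriminant) simp
    then show ?thesis by simp
  qed
  moreover have "y \<in> closure V" unfolding closure_sequential using u(1) y by blast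
  ultimately show thesis using that by blast
qed

text \<open>Zorn's lemma yields a maximal orthonormal set. Its span is dense, as a nonzero residual,
  once normalised, would extend it.\<close>

lemma orthonormal_basis_exists:
  obtains E :: "'a::{real_inner, complete_space} set" where "orthonormal_basis E"
proof -
  have "\<exists>M\<in>Collect orthonormal. \<forall>X\<in>Collect orthonormal. M \<subseteq> X \<longrightarrow> X = (M :: 'a set)"
  proof (rule subset_Zorn')
    fix \<C> :: "'a set set" assume "subset.chain (Collect orthonormal) \<C>"
    then have C: "\<C> \<subseteq> Collect orthonormal" "\<And>X Y. X \<in> \<C> \<Longrightarrow> Y \<in> \<C> \<Longrightarrow> X \<subseteq> Y \<or> Y \<subseteq> X"
      by (auto simp: subset_chain_def)
    then have "pairwise orthogonal (\<Union>\<C>)"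
      by (intro pairwise_chain_Union) (auto simp: chain_subset_def orthonormal_def)
    with C(1) show "\<Union>\<C> \<in> Collect orthonormal" by (auto simp: orthonormal_def)
  qed
  then obtain E :: "'a set" where E: "orthonormal E" and max: "\<And>X. orthonormal X \<Longrightarrow> E \<subseteq> X \<Longrightarrow> X = E"
    by blast
  have "x \<in> closure (span E)" for x
  proof -
    obtain y where y: "y \<in> closure (span E)" "\<And>z. z \<in> span E \<Longrightarrow> (x - y) \<bullet> z = 0"
      using orthogonal_residual_exists[OF subspace_span] by blast
    have "x = y"
    proof (rule ccontr)
      assume "x \<noteq> y"
      define e where "e = (1 / norm (x - y)) *\<^sub>R (x - y)"
      have e1: "norm e = 1" using \<open>x \<noteq> y\<close> by (simp add: e_def)
      have "orthogonal e z" if "z \<in> E" for z using y(2)[OF span_base[OF that]] by (simp add: orthogonal_def e_def)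
      then have "orthonormal (insert e E)"
        using E e1 by (auto simp: orthonormal_def intro: pairwise_orthogonal_insert)
      \<comment> \<open>Maximality puts \<open>e\<close> into \<open>E\<close>, to whose span it is
        orthogonal; so \<open>e \<bullet> e = 0\<close>.\<close>
      then have "e \<in> E" using max[of "insert e E"] by blast
      then have "(x - y) \<bullet> e = 0" by (intro y(2) span_base)
      then have "e \<bullet> e = 0" by (subst (1) e_def) simp
      then show False using e1 by simp
    qed
    with y(1) show ?thesis by simp
  qed
  then have "orthonormal_basis E" using E by (auto simp: orthonormal_basis_def orthonormal_def)
  then show thesis by (rule that)
qed

text \<open>The new span contains \<open>span E \<times> span F\<close>, whose closure is the
  product of the closures.\<close>

lemma orthonormal_basis_Times:
  assumes E: "orthonormal_basis E" and F: "orthonormal_basis F"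
  shows "orthonormal_basis ((\<lambda>e. (e, 0)) ` E \<union> Pair 0 ` F)" (is "orthonormal_basis ?G")
  unfolding orthonormal_basis_def
proof (intro conjI)
  show "pairwise orthogonal ?G"
    using E F by (auto simp: orthonormal_basis_def pairwise_def orthogonal_def inner_Pair; blast)
  show "\<forall>e\<in>?G. norm e = 1" using E F by (auto simp: orthonormal_basis_def norm_Pair)
  have sE: "(a, 0) \<in> span ?G" if "a \<in> span E" for a
  proof -
    have "(\<lambda>e. (e, 0)) ` span E = span ((\<lambda>e. (e, 0)) ` E)"
      by (intro linear_span_image[symmetric] linearI) auto
    also have "\<dots> \<subseteq> span ?G" by (rule span_mono) auto
    finally show ?thesis using that by auto
  qed
  have sF: "(0, b) \<in> span ?G" if "b \<in> span F" for b
  proof -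
    have "Pair 0 ` span F = span (Pair 0 ` F)" by (intro linear_span_image[symmetric] linearI) auto
    also have "\<dots> \<subseteq> span ?G" by (rule span_mono) auto
    finally show ?thesis using that by auto
  qed
  have "span E \<times> span F \<subseteq> span ?G" using span_add[OF sE sF] by auto
  then have "closure (span E \<times> span F) \<subseteq> closure (span ?G)" by (rule closure_mono)
  then show "closure (span ?G) = UNIV" using E F by (simp add: closure_Times orthonormal_basis_def top.extremum_unique)
qed

section \<open>Hilbert-Schmidt and trace class operators\<close>

text \<open>The double sum of \<open>(T e \<bullet> f)\<^sup>2\<close> is evaluated in both orders
  by Parseval; symmetry of \<open>T\<close> identifies the inner sum over \<open>e\<close> with the
  squared norm of \<open>T f\<close>.\<close>

lemma hilbert_schmidt_basis_indep:
  assumes T: "selfadjoint_op T" and E: "orthonormal_basis E" and F: "orthonormal_basis F"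
    and sm: "(\<lambda>e. (norm (T e))\<^sup>2) summable_on E"
  shows "(\<lambda>f. (norm (T f))\<^sup>2) summable_on F"
proof -
  have "(\<lambda>(e, f). (T e \<bullet> f)\<^sup>2) summable_on E \<times> F"
    by (rule summable_on_SigmaI[where g = "\<lambda>e. (norm (T e))\<^sup>2"]) (auto intro: Parseval[OF F] sm)
  then have "(\<lambda>(f, e). (T e \<bullet> f)\<^sup>2) summable_on F \<times> E" by (subst summable_on_swap) simp
  then obtain s where s: "((\<lambda>(f, e). (T e \<bullet> f)\<^sup>2) has_sum s) (F \<times> E)" by (auto simp: summable_on_def)
  have "((\<lambda>f. (norm (T f))\<^sup>2) has_sum s) F"
  proof (rule has_sum_SigmaD[OF s])
    have "T e \<bullet> f = T f \<bullet> e" for e f by (metis selfadjoint_opD(3)[OF T] inner_commute)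
    then show "((\<lambda>e. case (f, e) of (f, e) \<Rightarrow> (T e \<bullet> f)\<^sup>2) has_sum (norm (T f))\<^sup>2) E" for f
      using Parseval[OF E, of "T f"] by simp
  qed
  then show ?thesis by (auto simp: summable_on_def)
qed

text \<open>Lets the existential definition be tested on a basis of choice, such as that of a direct
  sum.\<close>

lemma hilbert_schmidt_iff:
  assumes "selfadjoint_op T" "orthonormal_basis E"
  shows "hilbert_schmidt T \<longleftrightarrow> (\<lambda>e. (norm (T e))\<^sup>2) summable_on E"
  using assms hilbert_schmidt_basis_indep[OF assms(1)] unfolding hilbert_schmidt_def
  by (auto dest: selfadjoint_opD)

section \<open>Direct sums of operators\<close>

lemma bounded_linear_map_prod:
  assumes "bounded_linear S" "bounded_linear T"
  shows "bounded_linear (map_prod S T)"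
  unfolding map_prod_def split_beta
  by (intro bounded_linear_Pair bounded_linear_compose[OF assms(1) bounded_linear_fst]
      bounded_linear_compose[OF assms(2) bounded_linear_snd])

lemma selfadjoint_op_map_prod:
  assumes "selfadjoint_op S" "selfadjoint_op T"
  shows "selfadjoint_op (map_prod S T)"
  using assms by (auto simp: selfadjoint_op_def bounded_linear_map_prod)

lemma positive_op_map_prod:
  assumes "positive_op S" "positive_op T"
  shows "positive_op (map_prod S T)"
  using assms by (auto simp: positive_op_def selfadjoint_op_map_prod)

lemma hilbert_schmidt_map_prod:
  fixes S :: "'a::{real_inner, complete_space} \<Rightarrow> 'a" and T :: "'b::{real_inner, complete_space} \<Rightarrow> 'b"
  assumes S: "selfadjoint_op S" and T: "selfadjoint_op T"
  shows "hilbert_schmidt (map_prod S T) \<longleftrightarrow> hilbert_schmidt S \<and> hilbert_schmidt T"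
proof -
  obtain E :: "'a set" where E: "orthonormal_basis E" by (rule orthonormal_basis_exists)
  obtain F :: "'b set" where F: "orthonormal_basis F" by (rule orthonormal_basis_exists)
  let ?n = "\<lambda>g. (norm (map_prod S T g))\<^sup>2"
  have 0: "S 0 = 0" "T 0 = 0" using S T by (auto dest!: selfadjoint_opD(2) simp: linear_0)
  have inj: "inj_on (\<lambda>e. (e, 0)) E" "inj_on (Pair 0) F" by (auto simp: inj_on_def)
  have 1: "?n summable_on (\<lambda>e. (e, 0)) ` E \<longleftrightarrow> (\<lambda>e. (norm (S e))\<^sup>2) summable_on E"
    by (simp add: summable_on_reindex[OF inj(1)] o_def norm_Pair 0)
  have 2: "?n summable_on Pair 0 ` F \<longleftrightarrow> (\<lambda>e. (norm (T e))\<^sup>2) summable_on F"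
    by (simp add: summable_on_reindex[OF inj(2)] o_def norm_Pair 0)
  \<comment> \<open>The two embedded bases could meet only in the zero vector.\<close>
  have "0 \<notin> E" using E by (auto simp: orthonormal_basis_def)
  then have disj: "(\<lambda>e. (e, 0)) ` E \<inter> Pair 0 ` F = {}" by auto
  have "hilbert_schmidt (map_prod S T) \<longleftrightarrow> ?n summable_on (\<lambda>e. (e, 0)) ` E \<union> Pair 0 ` F"
    by (rule hilbert_schmidt_iff[OF selfadjoint_op_map_prod[OF S T] orthonormal_basis_Times[OF E F]])
  also have "\<dots> \<longleftrightarrow> ?n summable_on (\<lambda>e. (e, 0)) ` E \<and> ?n summable_on Pair 0 ` F"
    by (intro iffI conjI; (elim conjE)?) (auto intro: summable_on_subset summable_on_Un_disjoint[OF _ _ disj])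
  also have "\<dots> \<longleftrightarrow> hilbert_schmidt S \<and> hilbert_schmidt T"
    by (simp only: 1 2 hilbert_schmidt_iff[OF S E] hilbert_schmidt_iff[OF T F])
  finally show ?thesis .
qed

lemma sqrt_op_map_prod:
  fixes S :: "'a::{real_inner, complete_space} \<Rightarrow> 'a" and T :: "'b::{real_inner, complete_space} \<Rightarrow> 'b"
  assumes "positive_op S" "positive_op T"
  shows "sqrt_op (map_prod S T) = map_prod (sqrt_op S) (sqrt_op T)"
  by (rule sqrt_op_eq)
     (simp_all add: positive_op_map_prod sqrt_op_works assms map_prod_compose[symmetric])

lemma adjoint_selfadjoint_op: "selfadjoint_op T \<Longrightarrow> adjoint T = T"
  by (rule adjoint_unique) (auto dest: selfadjoint_opD)

lemma positive_op_square:
  assumes "selfadjoint_op T"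
  shows "positive_op (T \<circ> T)"
  unfolding positive_op_def selfadjoint_op_def
proof (intro conjI allI)
  show "bounded_linear (T \<circ> T)" by (simp add: o_def bounded_linear_compose selfadjoint_opD(1)[OF assms])
  show "(T \<circ> T) x \<bullet> y = x \<bullet> (T \<circ> T) y" for x y by (simp add: selfadjoint_opD(3)[OF assms])
  show "0 \<le> x \<bullet> (T \<circ> T) x" for x
    using inner_ge_zero[of "T x"] by (simp add: selfadjoint_opD(3)[OF assms])
qed

lemma positive_op_abs_op:
  fixes T :: "'a::{real_inner, complete_space} \<Rightarrow> 'a"
  shows "selfadjoint_op T \<Longrightarrow> positive_op (abs_op T)"
  by (simp add: abs_op_def adjoint_selfadjoint_op positive_op_square sqrt_op_works)

text \<open>Each term of the trace of the absolute value is a squared norm under its square root;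
  the Hilbert-Schmidt results thus transfer to trace class operators.\<close>

lemma trace_class_iff_hilbert_schmidt:
  fixes T :: "'a::{real_inner, complete_space} \<Rightarrow> 'a"
  assumes T: "selfadjoint_op T"
  shows "trace_class T \<longleftrightarrow> hilbert_schmidt (sqrt_op (abs_op T))"
proof -
  note R = sqrt_op_works[OF positive_op_abs_op[OF T]]
  have "e \<bullet> abs_op T e = (norm (sqrt_op (abs_op T) e))\<^sup>2" for e
    using fun_cong[OF R(2), of e] by (simp add: power2_norm_eq_inner positive_opD(4)[OF R(1)])
  then show ?thesis
    using positive_opD(2)[OF R(1)] selfadjoint_opD(1)[OF T] by (simp add: trace_class_def hilbert_schmidt_def)
qed

text \<open>Absolute values and their square roots are both formed summand by summand.\<close>

lemma trace_class_map_prod: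
  fixes S :: "'a::{real_inner, complete_space} \<Rightarrow> 'a" and T :: "'b::{real_inner, complete_space} \<Rightarrow> 'b"
  assumes S: "selfadjoint_op S" and T: "selfadjoint_op T"
  shows "trace_class (map_prod S T) \<longleftrightarrow> trace_class S \<and> trace_class T"
proof -
  have "abs_op (map_prod S T) = map_prod (abs_op S) (abs_op T)"
    using assms by (simp add: abs_op_def adjoint_selfadjoint_op selfadjoint_op_map_prod map_prod_compose[symmetric]
        sqrt_op_map_prod positive_op_square)
  then show ?thesis
    using assms by (simp add: trace_class_iff_hilbert_schmidt selfadjoint_op_map_prod sqrt_op_map_prod
        positive_op_abs_op hilbert_schmidt_map_prod sqrt_op_works positive_opD(1))
qed

section \<open>Spectrum and complexification\<close>

text \<open>The real inverse is the real part of the complex inverse on real vectors,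
  \<open>x \<mapsto> fst (R (x, 0))\<close>.\<close>

lemma cinvertible_op_complexify_imp_invertible_op:
  assumes T: "bounded_linear T" and inv: "cinvertible_op (complexify T)"
  shows "invertible_op T"
proof -
  obtain R where R: "bounded_linear R" "R \<circ> complexify T = id" "complexify T \<circ> R = id"
    using inv by (auto simp: cinvertible_op_def cbounded_linear_def)
  have "bounded_linear (\<lambda>x. fst (R (x, 0)))"
    by (intro bounded_linear_compose[OF bounded_linear_fst] bounded_linear_compose[OF R(1)]
        bounded_linear_Pair bounded_linear_ident bounded_linear_zero)
  moreover have "(\<lambda>x. fst (R (x, 0))) \<circ> T = id"
  proof
    fix x show "((\<lambda>x. fst (R (x, 0))) \<circ> T) x = id x"
      using fun_cong[OF R(2), of "(x, 0)"] linear_0[OF bounded_linear.linear[OF T]]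
      by (simp add: complexify_def)
  qed
  moreover have "T \<circ> (\<lambda>x. fst (R (x, 0))) = id"
  proof
    fix x show "(T \<circ> (\<lambda>x. fst (R (x, 0)))) x = id x"
      using fun_cong[OF R(3), of "(x, 0)"] by (simp add: complexify_def split_beta)
  qed
  ultimately show ?thesis using T by (auto simp: invertible_op_def)
qed

section \<open>Positivity and invertibility from the spectrum\<close>

lemma of_real_not_in_spectrum_iff:
  "complex_of_real m \<notin> spectrum T \<longleftrightarrow> cinvertible_op (complexify (\<lambda>x. T x - m *\<^sub>R x))"
proof -
  have "(\<lambda>z. complexify T z - cscale (complex_of_real m) z) = complexify (\<lambda>x. T x - m *\<^sub>R x)"
    by (auto simp: complexify_def cscale_def)
  then show ?thesis by (simp add: spectrum_def cspectrum_def)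
qed

text \<open>The infimum \<open>m\<close> of the form over the unit sphere lies in the spectrum: since \<open>A - m\<close> is
  positive, it would otherwise be bounded below, and so would its form.\<close>

lemma positive_invertible_form_bound:
  fixes A :: "'a::real_inner \<Rightarrow> 'a"
  assumes "positive_invertible A"
  obtains m where "m > 0" "\<And>x. m * (x \<bullet> x) \<le> x \<bullet> A x"
proof (cases "\<forall>x::'a. x = 0")
  case True
  \<comment> \<open>In the zero space the unit sphere is empty and no infimum is available; any
    positive constant will do.\<close>
  then have "1 * (x \<bullet> x) \<le> x \<bullet> A x" for x by (metis inner_zero_left mult_zero_right order_refl)
  with that[of 1] show ?thesis by simp
next
  case False
  have A: "selfadjoint_op A" and spec: "spectrum A \<subseteq> complex_of_real ` {0<..}"
    using assms by (auto simp: positive_invertible_def)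
  note linA = selfadjoint_opD(2)[OF A]
  from False obtain x0 :: 'a where x0: "x0 \<noteq> 0" by blast
  let ?S = "sphere (0::'a) 1"
  have "(1 / norm x0) *\<^sub>R x0 \<in> ?S" using x0 by simp
  then have ne: "?S \<noteq> {}" by blast
  obtain K where K: "K > 0" "\<And>x. x \<bullet> (- A x) \<le> K * (x \<bullet> x)"
    using bounded_linear_form_bound[OF bounded_linear_minus[OF selfadjoint_opD(1)[OF A]]] by blast
  have bdd: "bdd_below ((\<lambda>x. x \<bullet> A x) ` ?S)"
  proof (rule bdd_belowI2)
    fix x assume "x \<in> ?S"
    then have "x \<bullet> x = 1" by (simp flip: power2_norm_eq_inner)
    with K(2)[of x] show "- K \<le> x \<bullet> A x" by simp
  qed
  define m where "m = (INF x\<in>?S. x \<bullet> A x)"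
  have low: "m * (x \<bullet> x) \<le> x \<bullet> A x" for x
  proof (cases "x = 0")
    case False
    let ?u = "(1 / norm x) *\<^sub>R x"
    have "m \<le> ?u \<bullet> A ?u" unfolding m_def using False by (intro cINF_lower[OF bdd]) simp
    also have "\<dots> = (x \<bullet> A x) / (norm x)\<^sup>2" by (simp add: linear_scale[OF linA] power2_eq_square)
    finally show ?thesis using False by (simp add: field_simps power2_norm_eq_inner)
  qed (simp add: linear_0[OF linA])
  define T where "T x = A x - m *\<^sub>R x" for x
  have saT: "selfadjoint_op T"
    unfolding T_def by (intro selfadjoint_op_minus A selfadjoint_op_scaleR)
  then have T: "positive_op T" using low by (simp add: positive_op_def T_def inner_diff_right)
  have "\<not> invertible_op T"
  proof
    assume "invertible_op T"
    then obtain G where G: "bounded_linear G" "G \<circ> T = id" by (auto simp: invertible_op_def)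
    obtain b where b: "b > 0" "\<And>x. norm (G x) \<le> norm x * b"
      using bounded_linear.pos_bounded[OF G(1)] by blast
    obtain k where k: "k > 0" "\<And>x. x \<bullet> T x \<le> k * (x \<bullet> x)"
      using bounded_linear_form_bound[OF selfadjoint_opD(1)[OF saT]] by blast
    \<comment> \<open>On the sphere \<open>1 \<le> b\<^sup>2 (norm (T x))\<^sup>2 \<le> k b\<^sup>2
      (x \<bullet> T x)\<close>, so the form of \<open>A\<close> would stay above its own infimum by
      \<open>1 / (k * b\<^sup>2)\<close>.\<close>
    have "m + 1 / (k * b\<^sup>2) \<le> m"
      unfolding m_def
    proof (rule cINF_greatest[OF ne], fold m_def)
      fix x assume x: "x \<in> ?S"
      have "norm x \<le> norm (T x) * b" using b(2)[of "T x"] fun_cong[OF G(2), of x] by simp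
      then have "1 \<le> (norm (T x) * b)\<^sup>2" using x by (simp add: one_le_power)
      also have "\<dots> = (norm (T x))\<^sup>2 * b\<^sup>2" by (simp add: power_mult_distrib)
      also have "\<dots> \<le> k * (x \<bullet> T x) * b\<^sup>2"
        by (intro mult_right_mono positive_op_norm_bound[OF T k(2)]) simp
      finally have "1 / (k * b\<^sup>2) \<le> x \<bullet> T x" using k(1) b(1) by (simp add: field_simps)
      moreover have "x \<bullet> T x = x \<bullet> A x - m"
        using x by (simp add: T_def inner_diff_right flip: power2_norm_eq_inner)
      ultimately show "m + 1 / (k * b\<^sup>2) \<le> x \<bullet> A x" by simp
    qed
    moreover have "1 / (k * b\<^sup>2) > 0" using k(1) b(1) by simp
    ultimately show False by linarith
  qed
  then have "\<not> cinvertible_op (complexify T)"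
    using cinvertible_op_complexify_imp_invertible_op selfadjoint_opD(1)[OF saT] by blast
  then have "complex_of_real m \<in> spectrum A"
    using of_real_not_in_spectrum_iff[of m A] unfolding T_def by blast
  then have "m > 0" using spec by auto
  with low that show ?thesis by blast
qed

lemma positive_invertible_imp_positive_op: "positive_invertible A \<Longrightarrow> positive_op A"
  unfolding positive_op_def
  by (meson inner_ge_zero less_imp_le mult_nonneg_nonneg order_trans positive_invertible_def positive_invertible_form_bound)

lemma positive_invertible_imp_invertible_op:
  assumes "positive_invertible A"
  shows "invertible_op A"
proof -
  have "complex_of_real 0 \<notin> spectrum A" using assms by (auto simp: positive_invertible_def)
  then have "cinvertible_op (complexify A)" unfolding of_real_not_in_spectrum_iff by simp
  then show ?thesis
    using assms by (intro cinvertible_op_complexify_imp_invertible_op)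
      (auto simp: positive_invertible_def dest: selfadjoint_opD)
qed

lemma selfadjoint_op_inverse:
  assumes B: "selfadjoint_op B" and R: "bounded_linear R" "B \<circ> R = id"
  shows "selfadjoint_op R"
  unfolding selfadjoint_op_def
proof (intro conjI allI R(1))
  have BR: "B (R x) = x" for x using fun_cong[OF R(2), of x] by simp
  show "R x \<bullet> y = x \<bullet> R y" for x y
    using selfadjoint_opD(3)[OF B, of "R x" "R y"] by (simp add: BR)
qed

text \<open>Symmetry of \<open>D\<close> cancels the imaginary part, leaving the sum of the real
  forms at \<open>x\<close> and \<open>y\<close>; \<open>y = 0\<close> isolates one of them.\<close>

lemma cpositive_op_complexify:
  assumes D: "selfadjoint_op D"
  shows "cpositive_op (complexify D) \<longleftrightarrow> (\<forall>x. 0 \<le> x \<bullet> D x)"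
proof -
  note lin = selfadjoint_opD(2)[OF D]
  have "complexify D = map_prod D D" by (auto simp: complexify_def)
  then have "bounded_linear (complexify D)"
    using D by (simp add: bounded_linear_map_prod selfadjoint_opD(1))
  then have "cbounded_linear (complexify D)"
    by (auto simp: cbounded_linear_def cscale_def complexify_def linear_add[OF lin] linear_diff[OF lin] linear_scale[OF lin])
  moreover have "cinner (x, y) (complexify D (x, y)) = complex_of_real (x \<bullet> D x + y \<bullet> D y)" for x y
    using selfadjoint_opD(3)[OF D, of x y]
    by (simp add: cinner_def complexify_def complex_of_real_def inner_commute[of y] complex_eq_iff)
  ultimately have "cpositive_op (complexify D) \<longleftrightarrow> (\<forall>x y. 0 \<le> x \<bullet> D x + y \<bullet> D y)"
    by (simp add: cpositive_op_def complex_nonneg_Reals_iff)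
  also have "\<dots> \<longleftrightarrow> (\<forall>x. 0 \<le> x \<bullet> D x)"
    by (metis add.right_neutral add_nonneg_nonneg inner_zero_left)
  finally show ?thesis .
qed

section \<open>The uncertainty condition as a real quadratic form\<close>

lemma bounded_linear_J_op: "bounded_linear J_op"
  unfolding J_op_def split_beta
  by (intro bounded_linear_Pair bounded_linear_minus bounded_linear_fst bounded_linear_snd)

text \<open>For \<open>z = x + \<i>y\<close> with \<open>x = (x\<^sub>1, x\<^sub>2)\<close> and \<open>y = (y\<^sub>1, y\<^sub>2)\<close>, the form of \<open>S - \<i>J\<close> is the sum of the
  forms below at \<open>(x\<^sub>1, y\<^sub>2)\<close> and at \<open>(- y\<^sub>1, x\<^sub>2)\<close>.\<close>

lemma uncertainty_map_prod:
  fixes A B :: "'a::real_inner \<Rightarrow> 'a"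
  assumes A: "selfadjoint_op A" and B: "selfadjoint_op B"
  shows "cpositive_op (\<lambda>z. complexify (map_prod A B) z - cscale \<i> (complexify J_op z))
    \<longleftrightarrow> (\<forall>a b. 0 \<le> a \<bullet> A a + b \<bullet> B b + 2 * (a \<bullet> b))"
proof -
  let ?T = "\<lambda>z. complexify (map_prod A B) z - cscale \<i> (complexify J_op z)"
  let ?q = "\<lambda>a b. a \<bullet> A a + b \<bullet> B b + 2 * (a \<bullet> b)"
  note linA = selfadjoint_opD(2)[OF A] and linB = selfadjoint_opD(2)[OF B]
  have T: "?T (x, y) = (map_prod A B x + J_op y, map_prod A B y - J_op x)" for x y
    by (simp add: complexify_def cscale_def)
  have "bounded_linear ?T"
  proof -
    have eq: "?T = (\<lambda>z. (map_prod A B (fst z) + J_op (snd z), map_prod A B (snd z) - J_op (fst z)))"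
      using T by (intro ext) (metis prod.collapse)
    note S = bounded_linear_map_prod[OF selfadjoint_opD(1)[OF A] selfadjoint_opD(1)[OF B]]
    show ?thesis unfolding eq
      by (intro bounded_linear_Pair bounded_linear_add bounded_linear_sub
          bounded_linear_compose[OF S] bounded_linear_compose[OF bounded_linear_J_op]
          bounded_linear_fst bounded_linear_snd)
  qed
  then have "cbounded_linear ?T"
    by (auto simp: cbounded_linear_def cscale_def complexify_def J_op_def linear_add[OF linA] linear_diff[OF linA]
        linear_scale[OF linA] linear_add[OF linB] linear_diff[OF linB] linear_scale[OF linB] algebra_simps)
  \<comment> \<open>The imaginary part vanishes, since \<open>map_prod A B\<close> is symmetric and
    \<open>x \<bullet> J_op x = 0\<close>.\<close>
  moreover have "cinner ((x1, x2), (y1, y2)) (?T ((x1, x2), (y1, y2)))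
      = complex_of_real (?q x1 y2 + ?q (- y1) x2)" for x1 x2 y1 y2
    using selfadjoint_opD(3)[OF A, of x1 y1] selfadjoint_opD(3)[OF B, of x2 y2]
    unfolding T by (simp add: cinner_def J_op_def complex_eq_iff inner_add_right inner_diff_right
        linear_neg[OF linA] inner_commute algebra_simps)
  ultimately have "cpositive_op ?T \<longleftrightarrow> (\<forall>x1 x2 y1 y2. 0 \<le> ?q x1 y2 + ?q (- y1) x2)"
    by (simp add: cpositive_op_def complex_nonneg_Reals_iff del: of_real_add)
  also have "\<dots> \<longleftrightarrow> (\<forall>a b. 0 \<le> ?q a b)"
  proof safe
    fix a b assume "\<forall>x1 x2 y1 y2. 0 \<le> ?q x1 y2 + ?q (- y1) x2"
    \<comment> \<open>Choosing \<open>y1 = 0\<close> and \<open>x2 = 0\<close> isolates the first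
      summand.\<close>
    then have "0 \<le> ?q a b + ?q (- 0) 0" by blast
    then show "0 \<le> ?q a b" by simp
  next
    fix x1 x2 y1 y2 assume "\<forall>a b. 0 \<le> ?q a b"
    then show "0 \<le> ?q x1 y2 + ?q (- y1) x2" by (intro add_nonneg_nonneg[of "?q x1 y2"]) blast+
  qed
  finally show ?thesis .
qed

lemma form_ge_inverse_iff:
  fixes A B R :: "'a::real_inner \<Rightarrow> 'a"
  assumes B: "positive_op B" and R: "bounded_linear R" "B \<circ> R = id" "R \<circ> B = id"
  shows "(\<forall>a b. 0 \<le> a \<bullet> A a + b \<bullet> B b + 2 * (a \<bullet> b)) \<longleftrightarrow> (\<forall>x. 0 \<le> x \<bullet> (A x - R x))"
proof -
  have BR: "B (R x) = x" "R (B x) = x" for x using fun_cong[OF R(2), of x] fun_cong[OF R(3), of x] by auto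
  note linB = positive_opD(3)[OF B]
  \<comment> \<open>Completing the square in \<open>b\<close>, with \<open>R\<close> the inverse of
    \<open>B\<close>.\<close>
  have sq: "a \<bullet> A a + b \<bullet> B b + 2 * (a \<bullet> b) = a \<bullet> (A a - R a) + (b + R a) \<bullet> B (b + R a)" for a b
    using positive_opD(4)[OF B, of "R a" b]
    by (simp add: linear_add[OF linB] BR inner_simps inner_commute algebra_simps)
  show ?thesis
  proof safe
    fix x assume "\<forall>a b. 0 \<le> a \<bullet> A a + b \<bullet> B b + 2 * (a \<bullet> b)"
    \<comment> \<open>The minimiser \<open>b = - R x\<close> makes the square vanish.\<close>
    then have "0 \<le> x \<bullet> (A x - R x) + (- R x + R x) \<bullet> B (- R x + R x)" unfolding sq by blast
    then show "0 \<le> x \<bullet> (A x - R x)" by simp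
  next
    fix a b assume "\<forall>x. 0 \<le> x \<bullet> (A x - R x)"
    then show "0 \<le> a \<bullet> A a + b \<bullet> B b + 2 * (a \<bullet> b)"
      unfolding sq using positive_opD(5)[OF B] by (simp add: add_nonneg_nonneg)
  qed
qed

text \<open>The product is block diagonal with blocks \<open>P Q Q P = P B P\<close> and
  \<open>Q P P Q = Q A Q\<close>; both collapse to \<open>A B\<close>, as \<open>P\<close> commutes
  with \<open>B\<close> and \<open>Q\<close> with \<open>A\<close>.\<close>

lemma symplectic_sqrt_map_prod:
  fixes A B :: "'a::{real_inner, complete_space} \<Rightarrow> 'a"
  assumes A: "positive_op A" and B: "positive_op B" and AB: "A \<circ> B = B \<circ> A"
  defines "K \<equiv> sqrt_op (map_prod A B) \<circ> J_op \<circ> sqrt_op (map_prod A B)"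
  shows "adjoint K \<circ> K = map_prod (A \<circ> B) (A \<circ> B)"
proof -
  define P Q where "P = sqrt_op A" and "Q = sqrt_op B"
  note P = sqrt_op_works[OF A, folded P_def] and Q = sqrt_op_works[OF B, folded Q_def]
  have K: "K (x, y) = (P (Q y), - Q (P x))" for x y
    unfolding K_def using positive_opD(3)[OF Q(1)]
    by (simp add: sqrt_op_map_prod A B J_op_def P_def Q_def linear_neg)
  have "adjoint K = (\<lambda>(x, y). (- P (Q y), Q (P x)))"
    by (rule adjoint_unique) (auto simp: K positive_opD(4)[OF P(1)] positive_opD(4)[OF Q(1)])
  \<comment> \<open>The mixed relations hold because a square root commutes with everything that
    commutes with its square.\<close>
  moreover have "P (P x) = A x" "Q (Q x) = B x" "B (P x) = P (B x)" "A (Q x) = Q (A x)" "A (B x) = B (A x)" for x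
    using P(2) Q(2) P(3)[OF positive_opD(2)[OF B]] Q(3)[OF positive_opD(2)[OF A]] AB
    by (auto simp: fun_eq_iff)
  ultimately show ?thesis
    using positive_opD(3)[OF P(1)] positive_opD(3)[OF Q(1)]
    by (auto simp: fun_eq_iff K linear_neg)
qed

theorem theorem11:
  fixes A B :: "'a::{real_inner, complete_space} \<Rightarrow> 'a"
    and S :: "'a \<times> 'a \<Rightarrow> 'a \<times> 'a"
  assumes "separable_space (euclidean :: 'a topology)"
    and "positive_invertible A"
    and "positive_invertible B"
    and "A \<circ> B = B \<circ> A"
    and "S = (\<lambda>(x, y). (A x, B y))"
  shows "gaussian_covariance_op S \<longleftrightarrow>
    cpositive_op (\<lambda>z. complexify A z - inv (complexify B) z) \<and>
    (hilbert_schmidt (\<lambda>x. A x - x) \<and> hilbert_schmidt (\<lambda>x. B x - x)) \<and>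
    trace_class (\<lambda>x. (A \<circ> B) x - x)"
proof -
  have S: "S = map_prod A B" using assms(5) by auto
  note pA = positive_invertible_imp_positive_op[OF assms(2)]
    and pB = positive_invertible_imp_positive_op[OF assms(3)]
  note sA = positive_opD(1)[OF pA] and sB = positive_opD(1)[OF pB]
  obtain Q where Q: "bounded_linear Q" "Q \<circ> A = id" "A \<circ> Q = id"
    using positive_invertible_imp_invertible_op[OF assms(2)] by (auto simp: invertible_op_def)
  obtain R where R: "bounded_linear R" "R \<circ> B = id" "B \<circ> R = id"
    using positive_invertible_imp_invertible_op[OF assms(3)] by (auto simp: invertible_op_def)
  \<comment> \<open>Symmetry and invertibility of \<open>S\<close> follow from the assumptions on
    \<open>A\<close> and \<open>B\<close>; the other three clauses are matched with the three
    conditions one by one.\<close>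
  have saS: "selfadjoint_op S" unfolding S by (rule selfadjoint_op_map_prod[OF sA sB])
  have invS: "invertible_op S"
    unfolding invertible_op_def
  proof (intro conjI exI)
    show "bounded_linear S" by (rule selfadjoint_opD(1)[OF saS])
    show "bounded_linear (map_prod Q R)" by (rule bounded_linear_map_prod[OF Q(1) R(1)])
    show "map_prod Q R \<circ> S = id" "S \<circ> map_prod Q R = id"
      unfolding S using Q R by (simp_all add: map_prod_compose[symmetric] map_prod.id)
  qed
  \<comment> \<open>The function inverse \<open>inv\<close> is identified through the two-sided
    inverse \<open>R\<close>.\<close>
  have "inv (complexify B) = complexify R"
    using R by (intro inv_unique_comp) (auto simp: complexify_def fun_eq_iff)
  then have "(\<lambda>z. complexify A z - inv (complexify B) z) = complexify (\<lambda>x. A x - R x)"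
    by (auto simp: complexify_def)
  then have 1: "cpositive_op (\<lambda>z. complexify A z - inv (complexify B) z)
      \<longleftrightarrow> cpositive_op (\<lambda>z. complexify S z - cscale \<i> (complexify J_op z))"
    unfolding S uncertainty_map_prod[OF sA sB] form_ge_inverse_iff[OF pB R(1,3,2)]
    by (simp add: cpositive_op_complexify selfadjoint_op_minus sA selfadjoint_op_inverse[OF sB R(1,3)])
  have "(\<lambda>x. S x - x) = map_prod (\<lambda>x. A x - x) (\<lambda>x. B x - x)" unfolding S by auto
  then have 2: "hilbert_schmidt (\<lambda>x. S x - x)
      \<longleftrightarrow> hilbert_schmidt (\<lambda>x. A x - x) \<and> hilbert_schmidt (\<lambda>x. B x - x)"
    by (simp add: hilbert_schmidt_map_prod selfadjoint_op_minus selfadjoint_op_ident sA sB)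
  let ?K = "sqrt_op S \<circ> J_op \<circ> sqrt_op S"
  \<comment> \<open>Here commutation makes the product symmetric, as the direct sum criterion for
    trace class operators requires.\<close>
  have "selfadjoint_op (A \<circ> B)"
    unfolding selfadjoint_op_def
  proof (intro conjI allI)
    show "bounded_linear (A \<circ> B)"
      unfolding o_def by (rule bounded_linear_compose[OF positive_opD(2)[OF pA] positive_opD(2)[OF pB]])
    show "(A \<circ> B) x \<bullet> y = x \<bullet> (A \<circ> B) y" for x y
      using fun_cong[OF assms(4), of y] by (simp add: positive_opD(4)[OF pA] positive_opD(4)[OF pB])
  qed
  then have sAB: "selfadjoint_op (\<lambda>x. (A \<circ> B) x - x)" by (intro selfadjoint_op_minus selfadjoint_op_ident)
  have "(\<lambda>x. (adjoint ?K \<circ> ?K) x - x) = map_prod (\<lambda>x. (A \<circ> B) x - x) (\<lambda>x. (A \<circ> B) x - x)"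
    unfolding S symplectic_sqrt_map_prod[OF pA pB assms(4)] by auto
  \<comment> \<open>The two diagonal blocks coincide, so the criterion gives the same condition
    twice.\<close>
  then have 3: "trace_class (\<lambda>x. (adjoint ?K \<circ> ?K) x - x) \<longleftrightarrow> trace_class (\<lambda>x. (A \<circ> B) x - x)"
    by (simp only: trace_class_map_prod[OF sAB sAB] conj_absorb)
  show ?thesis
    unfolding gaussian_covariance_op_def Let_def 1 2 3 using saS invS by blast
qed

end
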